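(* Let $K$ be a positive integer, $\mathcal K=\{1,\dots,K\}$, let $c_1\le c_2\le\dots\le c_K$ be positive integers, let $p_k\in(0,1]$ for $k\in\mathcal K$ and $P^{\mathrm{th}}_{\mathrm{out}}\in(0,1]$. Let $f(\mathbf z)=\sum_{k\in\mathcal K}c_kz_k$ and $\mathcal F=\{\mathbf z\in\{0,1\}^K:\ \prod_{k\in\mathcal K}p_k^{z_k}\le P^{\mathrm{th}}_{\mathrm{out}}\}$. Assume that the problem of minimizing $f$ over $\mathcal F$ is feasible, i.e. $\mathcal F\ne\emptyset$ (equivalently $\prod_{k\in\mathcal K}p_k\le P^{\mathrm{th}}_{\mathrm{out}}$), and let $\mathbf z^*\in\arg\min_{\mathbf z\in\mathcal F}f(\mathbf z)$. Put $c_{\max}=\max_{k\in\mathcal K}c_k$ and $\overline C=\sum_{k\in\mathcal K}c_k$. Then, for every input parameter $\epsilon>0$, Algorithm 2 (defined in the context) produces a vector $\tilde{\mathbf z}^*\in\mathcal F$ such that $$f(\mathbf z^* )\ \le\ f(\tilde{\mathbf z}^* )\ \le\ f(\mathbf z^* )+\min\big(\lfloor\epsilon c_{\max}\rfloor,\ \overline C\big).$$ In addition, for any $0<\epsilon<1/c_{\max}$, Algorithm 2 always finds an optimal solution, i.e. $f(\tilde{\mathbf z}^* )=f(\mathbf z^* )$.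
   Context: Algorithm 1 (dynamic programming). Input: a positive integer $K$, positive integers $c_1\le\dots\le c_K$, $p_1,\dots,p_K\in(0,1]$, and $P^{\mathrm{th}}_{\mathrm{out}}\in(0,1]$ with $\prod_{k}p_k\le P^{\mathrm{th}}_{\mathrm{out}}$. Arithmetic on real numbers is exact. (i) Set $a_k:=-\log(p_k)$ for all $k$ and $b:=-\log(P^{\mathrm{th}}_{\mathrm{out}})$. (ii) Set $A:=0$, $C:=0$, $k:=1$; while $A<b$ do: $A:=A+a_k$, $C:=C+c_k$, $k:=k+1$. (iii) Set $R(0,0):=0$ and $R(0,j):=-\infty$ for $j=1,\dots,C$. For $i=1,\dots,K$ and $j=0,\dots,C$ set $R(i,j):=\max\{R(i-1,j),\,a_i+R(i-1,j-c_i)\}$ if $j\ge c_i$, and $R(i,j):=R(i-1,j)$ otherwise. (iv) Set $j^*:=\min\{j\in\{0,\dots,C\}:R(K,j)\ge b\}$, $q:=R(K,j^* )$, $j:=j^*$. For $i=K,K-1,\dots,1$: if $q=R(i-1,j)$, set $z_i:=0$ and $q:=R(i-1,j)$; otherwise set $z_i:=1$, $q:=R(i-1,j-c_i)$, $j:=j-c_i$. Output: $[z_1,\dots,z_K]$. Algorithm 2 (approximation algorithm). Input: the same data as Algorithm 1, together with a real $\epsilon>0$. Set $\vartheta:=\epsilon c_{\max}/K$ with $c_{\max}=\max_kc_k=c_K$, and $\tilde c_k:=\lceil c_k/\vartheta\rceil$ for all $k$ (positive integers with $\tilde c_1\le\dots\le\tilde c_K$). Run Algorithm 1 with input $[K,(\tilde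 c_1,\dots,\tilde c_K),(p_1,\dots,p_K),P^{\mathrm{th}}_{\mathrm{out}}]$ and return its output $\tilde{\mathbf z}^*$. *)

theory Defs
  imports
    Complex_Main
    "HOL-Library.Extended_Real"
    "HOL-Library.FuncSet"
    "HOL-Library.While_Combinator"
begin

text \<open>Vectors indexed by \<open>1, \<dots>, K\<close> are functions on \<open>nat\<close>. Those in \<open>{0,1}\<^sup>K\<close> are taken
  extensional on \<open>{1..K}\<close>, so that each is represented by exactly one function. The data \<open>c\<close> and
  \<open>p\<close> are arbitrary outside \<open>{1..K}\<close>.\<close>

definition cost :: "nat \<Rightarrow> (nat \<Rightarrow> nat) \<Rightarrow> (nat \<Rightarrow> nat) \<Rightarrow> nat" where
  "cost K c z = (\<Sum>k=1..K. c k * z k)"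

definition feasible_set :: "nat \<Rightarrow> (nat \<Rightarrow> real) \<Rightarrow> real \<Rightarrow> (nat \<Rightarrow> nat) set" where
  "feasible_set K p Pth = {z \<in> {1..K} \<rightarrow>\<^sub>E {0, 1}. (\<Prod>k=1..K. p k ^ z k) \<le> Pth}"

definition c_max :: "nat \<Rightarrow> (nat \<Rightarrow> nat) \<Rightarrow> nat" where
  "c_max K c = Max (c ` {1..K})"

text \<open>The table is defined for every column \<open>j\<close>; entries in columns up to \<open>C\<close> depend only on
  such columns, so truncating the table at \<open>C\<close> does not change them.\<close>

fun dp_table :: "(nat \<Rightarrow> real) \<Rightarrow> (nat \<Rightarrow> nat) \<Rightarrow> nat \<Rightarrow> nat \<Rightarrow> ereal" where
  "dp_table a c 0 j = (if j = 0 then 0 else -\<infinity>)"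
| "dp_table a c (Suc i) j =
     (if j \<ge> c (Suc i)
      then max (dp_table a c i j) (ereal (a (Suc i)) + dp_table a c i (j - c (Suc i)))
      else dp_table a c i j)"

text \<open>The recursion argument is the loop index, running downwards to 1; \<open>q\<close>, \<open>j\<close>, \<open>z\<close> are the
  program variables.\<close>

fun backtrack ::
  "(nat \<Rightarrow> nat \<Rightarrow> ereal) \<Rightarrow> (nat \<Rightarrow> nat) \<Rightarrow> nat \<Rightarrow> ereal \<Rightarrow> nat \<Rightarrow> (nat \<Rightarrow> nat) \<Rightarrow> (nat \<Rightarrow> nat)"
where
  "backtrack R c 0 q j z = z"
| "backtrack R c (Suc i) q j z =
     (if q = R i j
      then backtrack R c i (R i j) j (z(Suc i := 0))
      else backtrack R c i (R i (j - c (Suc i))) (j - c (Suc i)) (z(Suc i := 1)))"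

text \<open>The result is \<open>None\<close> if the loop that determines the table width \<open>C\<close> does not terminate, or
  if no column \<open>j \<le> C\<close> reaches the threshold \<open>b\<close>.\<close>

definition dp_algorithm ::
  "nat \<Rightarrow> (nat \<Rightarrow> nat) \<Rightarrow> (nat \<Rightarrow> real) \<Rightarrow> real \<Rightarrow> (nat \<Rightarrow> nat) option"
where
  "dp_algorithm K c p Pth =
    (let a = (\<lambda>k. - ln (p k)); b = - ln Pth in
     case while_option (\<lambda>(A, C, k). A < b) (\<lambda>(A, C, k). (A + a k, C + c k, k + 1))
            (0 :: real, 0 :: nat, 1 :: nat) of
       None \<Rightarrow> None
     | Some (A, C, k) \<Rightarrow>
         (let R = dp_table a c; J = {j \<in> {0..C}. R K j \<ge> ereal b} in
          if J = {} then None
          else (let jmin = Min J in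
                Some (backtrack R c K (R K jmin) jmin (\<lambda>_. undefined)))))"

definition approx_algorithm ::
  "nat \<Rightarrow> (nat \<Rightarrow> nat) \<Rightarrow> (nat \<Rightarrow> real) \<Rightarrow> real \<Rightarrow> real \<Rightarrow> (nat \<Rightarrow> nat) option"
where
  "approx_algorithm K c p Pth \<epsilon> =
    (let \<theta> = \<epsilon> * real (c_max K c) / real K in
     dp_algorithm K (\<lambda>k. nat \<lceil>real (c k) / \<theta>\<rceil>) p Pth)"

end

theory Submission imports Defs begin

text \<open>Algorithm 1 solves the problem exactly: \<open>R(i, j)\<close> is the largest \<open>\<Sum>a\<^sub>kz\<^sub>k\<close> over
  \<open>z \<in> {0,1}\<^sup>i\<close> of cost exactly \<open>j\<close>, and after taking logarithms feasibility reads
  \<open>\<Sum>a\<^sub>kz\<^sub>k \<ge> b\<close>. Feasibility of the all-ones vector makes the loop for \<open>C\<close> stop after some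
  \<open>m \<le> K\<close> steps, and the indicator of \<open>{1..m}\<close> shows that column \<open>C\<close> reaches \<open>b\<close>. For
  Algorithm 2, \<open>c\<^sub>k \<le> \<theta>\<lceil>c\<^sub>k/\<theta>\<rceil> \<le> c\<^sub>k + \<theta>\<close>, so that an optimum for the rounded costs loses at
  most \<open>K\<theta> = \<epsilon>c\<^sub>m\<^sub>a\<^sub>x\<close> in the original ones.\<close>

section \<open>Table entries and backtracking\<close>

lemma cost_0 [simp]: "cost 0 c z = 0"
  by (simp add: cost_def)

lemma cost_Suc [simp]: "cost (Suc i) c z = cost i c z + c (Suc i) * z (Suc i)"
  by (simp add: cost_def)

text \<open>Induction along the recursion: \<open>y (Suc i) = 0\<close> is covered by the entry
  \<open>dp_table a c i j\<close>, which is a lower bound in either branch;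
  \<open>y (Suc i) = 1\<close> makes the cost at least \<open>c (Suc i)\<close>, so the second
  argument of \<open>max\<close> is available.\<close>

lemma dp_table_ge_value:
  assumes "\<And>k. k \<in> {1..i} \<Longrightarrow> y k \<in> {0, 1}"
  shows "ereal (\<Sum>k=1..i. a k * real (y k)) \<le> dp_table a c i (cost i c y)"
  using assms
proof (induction i)
  case 0
  then show ?case by simp
next
  case (Suc i)
  have IH: "ereal (\<Sum>k=1..i. a k * real (y k)) \<le> dp_table a c i (cost i c y)"
    using Suc by auto
  have "y (Suc i) \<in> {0, 1}"
    using Suc.prems by auto
  then consider "y (Suc i) = 0" | "y (Suc i) = 1"
    by auto
  then show ?case
  proof cases
    case 1
    with IH show ?thesis by (auto simp: le_max_iff_disj)
  next
    case 2
    have "ereal (a (Suc i)) + ereal (\<Sum>k=1..i. a k * real (y k))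
        \<le> ereal (a (Suc i)) + dp_table a c i (cost i c y)"
      using IH by (rule add_left_mono)
    with 2 show ?thesis by (simp add: le_max_iff_disj add.commute)
  qed
qed

text \<open>Used twice: an entry once written survives the rest of the loop, and the output keeps
  its initial value outside \<open>{1..K}\<close>.\<close>

lemma backtrack_outside: "k \<notin> {1..i} \<Longrightarrow> backtrack R c i q j z k = z k"
  by (induction i arbitrary: q j z) auto

text \<open>Every entry other than \<open>-\<infinity>\<close> is attained, and backtracking finds a
  witness. Each step keeps the current entry different from \<open>-\<infinity>\<close>, which in
  row 0 forces \<open>j = 0\<close>.\<close>

lemma backtrack_dp_table:
  fixes z :: "nat \<Rightarrow> nat"
  assumes "dp_table a c i j \<noteq> -\<infinity>"
  defines "z' \<equiv> backtrack (dp_table a c) c i (dp_table a c i j) j z"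
  shows "(\<forall>k\<in>{1..i}. z' k \<in> {0, 1}) \<and> cost i c z' = j \<and>
         ereal (\<Sum>k=1..i. a k * real (z' k)) = dp_table a c i j"
  using assms(1) unfolding z'_def
proof (induction i arbitrary: j z)
  case 0
  then show ?case by (simp split: if_splits)
next
  case (Suc i)
  show ?case
  proof (cases "dp_table a c (Suc i) j = dp_table a c i j")
    case True
    let ?z = "backtrack (dp_table a c) c i (dp_table a c i j) j (z(Suc i := 0))"
    have eq: "backtrack (dp_table a c) c (Suc i) (dp_table a c (Suc i) j) j z = ?z"
      using True by simp
    have last: "?z (Suc i) = 0"
      by (simp add: backtrack_outside)
    have "dp_table a c i j \<noteq> -\<infinity>"
      using Suc.prems True by metis
    from Suc.IH[OF this, of "z(Suc i := 0)"]
    have IH: "\<forall>k\<in>{1..i}. ?z k \<in> {0, 1}" "cost i c ?z = j"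
      "ereal (\<Sum>k=1..i. a k * real (?z k)) = dp_table a c i j"
      by blast+
    have "ereal (\<Sum>k=1..Suc i. a k * real (?z k)) = dp_table a c i j"
      using IH(3) last by simp
    then show ?thesis
      unfolding eq unfolding True using IH(1,2) last by (simp add: atLeastAtMostSuc_conv)
  next
    case False
    let ?j = "j - c (Suc i)"
    let ?z = "backtrack (dp_table a c) c i (dp_table a c i ?j) ?j (z(Suc i := 1))"
    have eq: "backtrack (dp_table a c) c (Suc i) (dp_table a c (Suc i) j) j z = ?z"
      using False by simp
    have last: "?z (Suc i) = 1"
      by (simp add: backtrack_outside)
    \<comment> \<open>Otherwise the recursion would copy the entry of the row before. Hence the
      subtraction in \<open>?j\<close> is not truncated.\<close>
    have j: "c (Suc i) \<le> j"
      using False by (auto split: if_splits)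
    have R: "dp_table a c (Suc i) j = ereal (a (Suc i)) + dp_table a c i ?j"
      using False by (auto simp: max_def split: if_splits)
    have "dp_table a c i ?j \<noteq> -\<infinity>"
      using Suc.prems R by auto
    from Suc.IH[OF this, of "z(Suc i := 1)"]
    have IH: "\<forall>k\<in>{1..i}. ?z k \<in> {0, 1}" "cost i c ?z = ?j"
      "ereal (\<Sum>k=1..i. a k * real (?z k)) = dp_table a c i ?j"
      by blast+
    have "ereal (\<Sum>k=1..Suc i. a k * real (?z k))
        = ereal (a (Suc i)) + ereal (\<Sum>k=1..i. a k * real (?z k))"
      using last by (simp add: add.commute)
    also have "\<dots> = ereal (a (Suc i)) + dp_table a c i ?j"
      by (simp only: IH(3))
    finally show ?thesis
      unfolding eq unfolding R using IH(1,2) last j by (simp add: atLeastAtMostSuc_conv)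
  qed
qed

section \<open>Logarithmic constraint and table width\<close>

lemma prod_power_le_iff_sum_ln:
  fixes p :: "nat \<Rightarrow> real"
  assumes "\<And>k. k \<in> {1..K} \<Longrightarrow> 0 < p k" and "0 < Pth"
  shows "(\<Prod>k=1..K. p k ^ z k) \<le> Pth \<longleftrightarrow> - ln Pth \<le> (\<Sum>k=1..K. - ln (p k) * real (z k))"
proof -
  have pos: "0 < (\<Prod>k=1..K. p k ^ z k)"
    using assms(1) by (intro prod_pos) auto
  have "p k ^ z k \<noteq> 0" "ln (p k ^ z k) = ln (p k) * real (z k)" if "k \<in> {1..K}" for k
    using assms(1)[OF that] by (simp_all add: ln_realpow)
  then have "ln (\<Prod>k=1..K. p k ^ z k) = (\<Sum>k=1..K. ln (p k) * real (z k))"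
    by (subst ln_prod) (use assms(1) in auto)
  moreover have "(\<Prod>k=1..K. p k ^ z k) \<le> Pth \<longleftrightarrow> ln (\<Prod>k=1..K. p k ^ z k) \<le> ln Pth"
    using pos assms(2) by simp
  ultimately show ?thesis
    by (simp add: sum_negf)
qed

text \<open>The invariant \<open>P\<close> says that the state holds the partial sums up to some
  \<open>m \<le> K\<close>. At \<open>m = K\<close> the assumption falsifies the guard, so a further
  step stays within \<open>K\<close> and decreases \<open>Suc K - k\<close>.\<close>

lemma width_loop_terminates:
  fixes a :: "nat \<Rightarrow> real" and b :: real
  assumes "b \<le> (\<Sum>k=1..K. a k)"
  shows "\<exists>m\<le>K. b \<le> (\<Sum>k=1..m. a k) \<and>
    while_option (\<lambda>(A, C, k). A < b) (\<lambda>(A, C, k). (A + a k, C + c k, k + 1)) (0, 0 :: nat, 1)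
      = Some (\<Sum>k=1..m. a k, \<Sum>k=1..m. c k, Suc m)"
proof -
  define P where "P = (\<lambda>(A, C, k).
    \<exists>m\<le>K. k = Suc m \<and> A = (\<Sum>k=1..m. a k) \<and> C = (\<Sum>k=1..m. c k))"
  let ?guard = "\<lambda>(A, C, k). A < b" and ?body = "\<lambda>(A, C, k). (A + a k, C + c k, k + 1)"
  have step: "P (?body s) \<and> Suc K - snd (snd (?body s)) < Suc K - snd (snd s)"
    if s: "P s" "?guard s" for s
  proof -
    obtain m where m: "m \<le> K" "s = (\<Sum>k=1..m. a k, \<Sum>k=1..m. c k, Suc m)"
      using s(1) by (auto simp: P_def)
    then have "m \<noteq> K"
      using s(2) assms by auto
    with m(1) have "Suc m \<le> K" by simp
    with m(2) show ?thesis
      by (auto simp: P_def intro!: exI[of _ "Suc m"])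
  qed
  have init: "P (0, 0, 1)"
    by (auto simp: P_def)
  obtain t where t: "while_option ?guard ?body (0, 0, 1) = Some t"
    using measure_while_option_Some[where P = P and b = ?guard and c = ?body
        and f = "\<lambda>s. Suc K - snd (snd s)", OF step init] by blast
  have "P t"
    using while_option_rule[where P = P, OF _ t init] step by blast
  moreover have "\<not> ?guard t"
    using t by (rule while_option_stop)
  ultimately show ?thesis
    using t by (auto simp: P_def)
qed

section \<open>Exactness of Algorithm 1\<close>

lemma dp_algorithm_optimal:
  assumes "\<And>k. k \<in> {1..K} \<Longrightarrow> 0 < p k" and "0 < Pth" and "(\<Prod>k=1..K. p k) \<le> Pth"
  shows "\<exists>z. dp_algorithm K c p Pth = Some z \<and>
    is_arg_min (cost K c) (\<lambda>z. z \<in> feasible_set K p Pth) z"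
proof -
  define a where "a = (\<lambda>k. - ln (p k))"
  define b where "b = - ln Pth"
  define R where "R = dp_table a c"
  have value_iff: "(\<Prod>k=1..K. p k ^ y k) \<le> Pth \<longleftrightarrow> b \<le> (\<Sum>k=1..K. a k * real (y k))" for y
    unfolding a_def b_def using assms(1,2) by (rule prod_power_le_iff_sum_ln)
  have feasible_iff: "y \<in> feasible_set K p Pth \<longleftrightarrow>
      y \<in> {1..K} \<rightarrow>\<^sub>E {0, 1} \<and> b \<le> (\<Sum>k=1..K. a k * real (y k))" for y
    using value_iff by (simp add: feasible_set_def)
  have "b \<le> (\<Sum>k=1..K. a k)"
    using value_iff[of "\<lambda>_. 1"] assms(3) by simp
  from width_loop_terminates[OF this, of c] obtain m where m: "m \<le> K" "b \<le> (\<Sum>k=1..m. a k)"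
    and loop: "while_option (\<lambda>(A, C, k). A < b) (\<lambda>(A, C, k). (A + a k, C + c k, k + 1)) (0, 0, 1)
      = Some (\<Sum>k=1..m. a k, \<Sum>k=1..m. c k, Suc m)"
    by blast
  define C where "C = (\<Sum>k=1..m. c k)"
  define J where "J = {j \<in> {0..C}. ereal b \<le> R K j}"
  define e :: "nat \<Rightarrow> nat" where "e = (\<lambda>k. if k \<le> m then 1 else 0)"
  have restrict: "{1..K} \<inter> {k. k \<le> m} = {1..m}"
    using m(1) by auto
  have "cost K c e = C"
    by (simp add: cost_def C_def e_def if_distrib[of "(*) _"] sum.If_cases restrict
        del: One_nat_def cong: if_cong)
  moreover have "(\<Sum>k=1..K. a k * real (e k)) = (\<Sum>k=1..m. a k)"
    by (simp add: e_def if_distrib[of "(*) _"] if_distrib[of real] sum.If_cases restrict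
        del: One_nat_def cong: if_cong)
  moreover have "ereal (\<Sum>k=1..K. a k * real (e k)) \<le> R K (cost K c e)"
    unfolding R_def by (rule dp_table_ge_value) (auto simp: e_def)
  ultimately have "ereal b \<le> R K C"
    using m(2) by (metis ereal_less_eq(3) order_trans)
  then have "C \<in> J" and "finite J" and "J \<noteq> {}"
    by (auto simp: J_def)
  define j where "j = Min J"
  define z where "z = backtrack R c K (R K j) j (\<lambda>_. undefined)"
  have "j \<in> J"
    using \<open>finite J\<close> \<open>J \<noteq> {}\<close> by (simp add: j_def)
  then have j: "j \<le> C" "ereal b \<le> R K j"
    by (auto simp: J_def)
  then have "R K j \<noteq> -\<infinity>"
    by auto
  from backtrack_dp_table[OF this[unfolded R_def], of "\<lambda>_. undefined", folded R_def, folded z_def]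
  have z: "\<forall>k\<in>{1..K}. z k \<in> {0, 1}" "cost K c z = j" "ereal (\<Sum>k=1..K. a k * real (z k)) = R K j"
    by auto
  \<comment> \<open>Starting the backtracking from the constant \<open>undefined\<close> is what
    makes \<open>z\<close> extensional.\<close>
  have "z \<in> {1..K} \<rightarrow>\<^sub>E {0, 1}"
    using z(1) by (auto simp: PiE_iff extensional_def z_def backtrack_outside)
  moreover have "b \<le> (\<Sum>k=1..K. a k * real (z k))"
    using j(2) z(3) by (metis ereal_less_eq(3))
  ultimately have "z \<in> feasible_set K p Pth"
    by (simp add: feasible_iff)
  \<comment> \<open>\<open>J\<close> only sees columns up to \<open>C\<close>. A feasible
    \<open>y\<close> of cost at most \<open>C\<close> puts its cost into \<open>J\<close>; a dearer
    one cannot beat \<open>j \<le> C\<close>.\<close>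
  moreover have "cost K c z \<le> cost K c y" if "y \<in> feasible_set K p Pth" for y
  proof (cases "cost K c y \<le> C")
    case True
    have y: "y \<in> {1..K} \<rightarrow>\<^sub>E {0, 1}" "b \<le> (\<Sum>k=1..K. a k * real (y k))"
      using that by (auto simp: feasible_iff)
    have "ereal (\<Sum>k=1..K. a k * real (y k)) \<le> R K (cost K c y)"
      unfolding R_def using y(1) by (intro dp_table_ge_value) (auto simp: PiE_iff)
    with y(2) have "ereal b \<le> R K (cost K c y)"
      by (metis ereal_less_eq(3) order_trans)
    with True have "cost K c y \<in> J"
      by (simp add: J_def)
    with \<open>finite J\<close> z(2) show ?thesis
      by (simp add: j_def)
  next
    case False
    with z(2) j(1) show ?thesis by simp
  qed
  moreover have "dp_algorithm K c p Pth = Some z"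
    unfolding dp_algorithm_def Let_def a_def[symmetric] b_def[symmetric] R_def[symmetric]
      loop[folded C_def] option.case prod.case J_def[symmetric] j_def[symmetric] z_def[symmetric]
    using \<open>J \<noteq> {}\<close> by simp
  ultimately show ?thesis
    by (auto simp: is_arg_min_linorder)
qed

section \<open>Rounding of the costs\<close>

lemma scaled_ceiling_bounds:
  fixes \<theta> :: real
  assumes "\<theta> > 0"
  shows "real n \<le> \<theta> * real (nat \<lceil>real n / \<theta>\<rceil>)" and "\<theta> * real (nat \<lceil>real n / \<theta>\<rceil>) \<le> real n + \<theta>"
proof -
  have "0 \<le> real n / \<theta>"
    using assms by simp
  then have "real n / \<theta> \<le> real (nat \<lceil>real n / \<theta>\<rceil>)" "real (nat \<lceil>real n / \<theta>\<rceil>) \<le> real n / \<theta> + 1"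
    by linarith+
  from this[THEN mult_left_mono, of \<theta>] assms
  show "real n \<le> \<theta> * real (nat \<lceil>real n / \<theta>\<rceil>)" "\<theta> * real (nat \<lceil>real n / \<theta>\<rceil>) \<le> real n + \<theta>"
    by (simp_all add: distrib_left)
qed

text \<open>Each of the \<open>K\<close> indices is charged a full \<theta> for rounding, even where
  \<open>z k = 0\<close>, so the error bound does not depend on \<open>z\<close>.\<close>

lemma cost_scaled_ceiling_bounds:
  fixes c :: "nat \<Rightarrow> nat" and \<theta> :: real
  assumes "\<theta> > 0" and "\<And>k. k \<in> {1..K} \<Longrightarrow> z k \<in> {0, 1}"
  defines "c' \<equiv> \<lambda>k. nat \<lceil>real (c k) / \<theta>\<rceil>"
  shows "real (cost K c z) \<le> \<theta> * real (cost K c' z)"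
    and "\<theta> * real (cost K c' z) \<le> real (cost K c z) + real K * \<theta>"
proof -
  have expand: "\<theta> * real (cost K c' z) = (\<Sum>k=1..K. \<theta> * real (c' k) * real (z k))"
    by (simp add: cost_def sum_distrib_left mult.assoc)
  show "real (cost K c z) \<le> \<theta> * real (cost K c' z)"
    unfolding expand unfolding cost_def of_nat_sum of_nat_mult c'_def
    by (intro sum_mono mult_right_mono scaled_ceiling_bounds assms(1)) auto
  have "\<theta> * real (cost K c' z) \<le> (\<Sum>k=1..K. real (c k * z k) + \<theta>)"
    unfolding expand
  proof (rule sum_mono)
    fix k assume "k \<in> {1..K}"
    then show "\<theta> * real (c' k) * real (z k) \<le> real (c k * z k) + \<theta>"
      using assms(2)[of k] scaled_ceiling_bounds(2)[OF assms(1), of "c k"] assms(1)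
      by (auto simp: c'_def)
  qed
  then show "\<theta> * real (cost K c' z) \<le> real (cost K c z) + real K * \<theta>"
    by (simp add: cost_def sum.distrib)
qed

theorem theorem3:
  fixes K :: nat and c :: "nat \<Rightarrow> nat" and p :: "nat \<Rightarrow> real" and Pth :: real
    and zopt :: "nat \<Rightarrow> nat" and \<epsilon> :: real
  assumes "K \<ge> 1"
    and "\<And>k. k \<in> {1..K} \<Longrightarrow> c k > 0"
    and "mono_on {1..K} c"
    and "\<And>k. k \<in> {1..K} \<Longrightarrow> p k \<in> {0<..1}"
    and "Pth \<in> {0<..1}"
    and "feasible_set K p Pth \<noteq> {}"
    and "is_arg_min (cost K c) (\<lambda>z. z \<in> feasible_set K p Pth) zopt"
    and "\<epsilon> > 0"
  shows "\<exists>z. approx_algorithm K c p Pth \<epsilon> = Some z \<and>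
           z \<in> feasible_set K p Pth \<and>
           cost K c zopt \<le> cost K c z \<and>
           int (cost K c z) \<le> int (cost K c zopt)
             + min \<lfloor>\<epsilon> * real (c_max K c)\<rfloor> (int (\<Sum>k=1..K. c k)) \<and>
           (\<epsilon> < 1 / real (c_max K c) \<longrightarrow> cost K c z = cost K c zopt)"
proof -
  define \<theta> where "\<theta> = \<epsilon> * real (c_max K c) / real K"
  define c' where "c' = (\<lambda>k. nat \<lceil>real (c k) / \<theta>\<rceil>)"
  have "c 1 \<le> c_max K c"
    unfolding c_max_def using assms(1) by (intro Max_ge) auto
  with assms(1,2) have cmax: "c_max K c > 0"
    by force
  with assms(1,8) have \<theta>: "\<theta> > 0"
    by (simp add: \<theta>_def)
  have K\<theta>: "real K * \<theta> = \<epsilon> * real (c_max K c)"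
    using assms(1) by (simp add: \<theta>_def)
  have p: "0 < p k" "p k \<le> 1" if "k \<in> {1..K}" for k
    using assms(4)[OF that] by auto
  have bin: "y k \<in> {0, 1}" if "y \<in> feasible_set K p Pth" "k \<in> {1..K}" for y k
    using that by (auto simp: feasible_set_def PiE_iff)
  have zopt: "zopt \<in> feasible_set K p Pth"
    "\<And>y. y \<in> feasible_set K p Pth \<Longrightarrow> cost K c zopt \<le> cost K c y"
    using assms(7) by (auto simp: is_arg_min_linorder)
  \<comment> \<open>Since \<open>p k \<le> 1\<close>, raising all exponents to 1 can only lower the
    product: feasibility of \<open>zopt\<close> passes to the all-ones vector.\<close>
  have "(\<Prod>k=1..K. p k) \<le> (\<Prod>k=1..K. p k ^ zopt k)"
  proof (rule prod_mono)
    fix k assume k: "k \<in> {1..K}"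
    show "0 \<le> p k \<and> p k \<le> p k ^ zopt k"
      using bin[OF zopt(1) k] p[OF k] by auto
  qed
  also have "\<dots> \<le> Pth"
    using zopt(1) by (simp add: feasible_set_def)
  finally obtain z where z: "dp_algorithm K c' p Pth = Some z"
    "is_arg_min (cost K c') (\<lambda>z. z \<in> feasible_set K p Pth) z"
    using dp_algorithm_optimal[of K p Pth c'] p(1) assms(5) by auto
  then have feas: "z \<in> feasible_set K p Pth" and opt: "cost K c' z \<le> cost K c' zopt"
    using zopt(1) by (auto simp: is_arg_min_linorder)
  \<comment> \<open>Pass to the rounded costs, for which \<open>z\<close> is optimal, and return to
    the original ones at \<open>zopt\<close>.\<close>
  have "real (cost K c z) \<le> \<theta> * real (cost K c' z)"
    unfolding c'_def using \<theta> bin[OF feas] by (rule cost_scaled_ceiling_bounds)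
  also have "\<dots> \<le> \<theta> * real (cost K c' zopt)"
    using \<theta> opt by simp
  also have "\<dots> \<le> real (cost K c zopt) + real K * \<theta>"
    unfolding c'_def using \<theta> bin[OF zopt(1)] by (rule cost_scaled_ceiling_bounds)
  \<comment> \<open>Both costs are integers, so the real error bound may be replaced by its
    floor.\<close>
  finally have le: "int (cost K c z) \<le> int (cost K c zopt) + \<lfloor>\<epsilon> * real (c_max K c)\<rfloor>"
    unfolding K\<theta> by linarith
  have "cost K c z \<le> (\<Sum>k=1..K. c k)"
    unfolding cost_def
  proof (rule sum_mono)
    fix k assume "k \<in> {1..K}"
    then show "c k * z k \<le> c k"
      using bin[OF feas, of k] by auto
  qed
  with le have bound: "int (cost K c z) \<le> int (cost K c zopt)
      + min \<lfloor>\<epsilon> * real (c_max K c)\<rfloor> (int (\<Sum>k=1..K. c k))"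
    by linarith
  have exact: "cost K c z = cost K c zopt" if "\<epsilon> < 1 / real (c_max K c)"
  proof -
    have "\<epsilon> * real (c_max K c) < 1"
      using that cmax by (simp add: field_simps)
    \<comment> \<open>An additive error below 1 disappears under the floor; optimality of
      \<open>zopt\<close> gives the other inequality.\<close>
    then have "\<lfloor>\<epsilon> * real (c_max K c)\<rfloor> \<le> 0"
      by linarith
    with le zopt(2)[OF feas] show ?thesis
      by linarith
  qed
  have "approx_algorithm K c p Pth \<epsilon> = Some z"
    using z(1) by (simp add: approx_algorithm_def Let_def \<theta>_def c'_def)
  with feas zopt(2)[OF feas] bound exact show ?thesis
    by blast
qed

end
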